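(* Let $\Omega$ be a nonempty subset of $\mathbb{R}^n$, let $F\in\mathcal{F}^1(\Omega)$ and assume $\kappa:=\Gamma^1(F;\Omega)>0$. For $x\in\mathbb{R}^n$ let $$u^+(x)=\max_{v\in\Lambda_x}\inf_{a\in\Omega}\Psi^+(F,x,a,v),\qquad u^-(x)=\min_{v\in\Lambda_x}\sup_{a\in\Omega}\Psi^-(F,x,a,v).$$ Then for every minimal Lipschitz extension $G$ of $F$ on $\mathbb{R}^n$, $$u^-(x)\le g(x)\le u^+(x)\qquad\text{for all }x\in\mathbb{R}^n.$$
   Context: Fix an integer $n\ge 1$; $\mathbb{R}^n$ carries the standard scalar product and Euclidean norm. A 1-field on a nonempty set $\Omega\subset\mathbb{R}^n$ is a map $F$ assigning to each $x\in \Omega$ the polynomial $F(x)(a)=f_x+\langle D_xf,a-x\rangle$ ($a\in\mathbb{R}^n$), where $f_x\in\mathbb{R}$ and $D_xf\in\mathbb{R}^n$ (a 1-field $G$ similarly has associated data $g(x)=g_x$ and $D_xg$). For $x\ne y$ in $\Omega$, $$\Gamma^1(F;x,y)=2\sup_{a\in\mathbb{R}^n}\frac{|F(x)(a)-F(y)(a)|}{\|x-a\|^2+\|y-a\|^2},$$ and $\Gamma^1(F;\Omega)=\sup_{x\ne y\in \Omega}\Gamma^1(F;x,y)$. $\mathcal{F}^1(\Omega)$ is the set of 1-fields on $\Omega$ with $\Gamma^1(F;\Omega)<+\infty$. A minimal Lipschitz extension of $F\in\mathcal{F}^1(\Omega)$ on $\mathbb{R}^n$ is a $G\in\mathcal{F}^1(\mathbb{R}^n)$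 with $G(x)=F(x)$ for $x\in\Omega$ and $\Gamma^1(G;\mathbb{R}^n)=\Gamma^1(F;\Omega)$. For $a,b\in\Omega$ and $x\in\mathbb{R}^n$ set $$v_{a,b}=\tfrac12(D_af+D_bf)+\tfrac{\kappa}{2}(b-a),$$ $$\alpha_{a,b}=2\kappa(f_a-f_b)+\kappa\langle D_af+D_bf,b-a\rangle-\tfrac12\|D_af-D_bf\|^2+\tfrac{\kappa^2}{2}\|a-b\|^2,$$ $$\beta_{a,b}(x)=\left\|\tfrac12(D_af-D_bf)+\tfrac{\kappa}{2}(2x-a-b)\right\|^2,\qquad r_{a,b}(x)=\sqrt{\alpha_{a,b}+\beta_{a,b}(x)},$$ (it is known that $\alpha_{a,b}\ge0$), and $$\Lambda_x=\{v\in\mathbb{R}^n:\ \|v-v_{a,b}\|\le r_{a,b}(x)\ \text{for all } a,b\in\Omega\},$$ which is known to be nonempty. For $a\in\Omega$ and $x,v\in\mathbb{R}^n$, $$\Psi^\pm(F,x,a,v)=f_a+\tfrac12\langle D_af+v,x-a\rangle\pm\tfrac{\kappa}{4}\|a-x\|^2\mp\tfrac{1}{4\kappa}\|D_af-v\|^2.$$ *)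

theory Defs
  imports "HOL-Analysis.Analysis"
begin

text \<open>
  A 1-field is represented by its data: \<open>F x = (f\<^sub>x, D\<^sub>x f)\<close>. These determine the affine
  polynomial \<open>F(x)\<close> and are determined by it. Values of \<open>F\<close> outside the domain
  \<open>\<Omega>\<close> are irrelevant.
\<close>

type_synonym 'n field1 = "real^'n \<Rightarrow> real \<times> (real^'n)"

definition val :: "'n::finite field1 \<Rightarrow> real^'n \<Rightarrow> real" where
  "val F x = fst (F x)"

definition der :: "'n::finite field1 \<Rightarrow> real^'n \<Rightarrow> real^'n" where
  "der F x = snd (F x)"

definition poly1 :: "'n::finite field1 \<Rightarrow> real^'n \<Rightarrow> real^'n \<Rightarrow> real" where
  "poly1 F x a = val F x + der F x \<bullet> (a - x)"

text \<open>
  The suprema are taken in \<open>[0, \<infinity>]\<close>; in particular the supremum over an empty set of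
  pairs (one-point domain) is \<open>0\<close>.
\<close>

definition Gamma1_pt :: "'n::finite field1 \<Rightarrow> real^'n \<Rightarrow> real^'n \<Rightarrow> ennreal" where
  "Gamma1_pt F x y =
     2 * (SUP a. ennreal (\<bar>poly1 F x a - poly1 F y a\<bar> / ((norm (x - a))\<^sup>2 + (norm (y - a))\<^sup>2)))"

definition Gamma1 :: "'n::finite field1 \<Rightarrow> (real^'n) set \<Rightarrow> ennreal" where
  "Gamma1 F \<Omega> = (SUP (x, y) \<in> {(x, y). x \<in> \<Omega> \<and> y \<in> \<Omega> \<and> x \<noteq> y}. Gamma1_pt F x y)"

definition F1 :: "(real^'n) set \<Rightarrow> 'n::finite field1 set" where
  "F1 \<Omega> = {F. Gamma1 F \<Omega> < \<infinity>}"

definition minimal_extension :: "'n::finite field1 \<Rightarrow> (real^'n) set \<Rightarrow> 'n field1 \<Rightarrow> bool" where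
  "minimal_extension F \<Omega> G \<longleftrightarrow>
     G \<in> F1 UNIV \<and> (\<forall>x\<in>\<Omega>. G x = F x) \<and> Gamma1 G UNIV = Gamma1 F \<Omega>"

definition v_ab :: "real \<Rightarrow> 'n::finite field1 \<Rightarrow> real^'n \<Rightarrow> real^'n \<Rightarrow> real^'n" where
  "v_ab \<kappa> F a b = (1/2) *\<^sub>R (der F a + der F b) + (\<kappa>/2) *\<^sub>R (b - a)"

definition alpha_ab :: "real \<Rightarrow> 'n::finite field1 \<Rightarrow> real^'n \<Rightarrow> real^'n \<Rightarrow> real" where
  "alpha_ab \<kappa> F a b =
     2 * \<kappa> * (val F a - val F b) + \<kappa> * ((der F a + der F b) \<bullet> (b - a))
     - (1/2) * (norm (der F a - der F b))\<^sup>2 + (\<kappa>\<^sup>2/2) * (norm (a - b))\<^sup>2"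

definition beta_ab :: "real \<Rightarrow> 'n::finite field1 \<Rightarrow> real^'n \<Rightarrow> real^'n \<Rightarrow> real^'n \<Rightarrow> real" where
  "beta_ab \<kappa> F a b x =
     (norm ((1/2) *\<^sub>R (der F a - der F b) + (\<kappa>/2) *\<^sub>R (2 *\<^sub>R x - a - b)))\<^sup>2"

definition r_ab :: "real \<Rightarrow> 'n::finite field1 \<Rightarrow> real^'n \<Rightarrow> real^'n \<Rightarrow> real^'n \<Rightarrow> real" where
  "r_ab \<kappa> F a b x = sqrt (alpha_ab \<kappa> F a b + beta_ab \<kappa> F a b x)"

definition Lambda :: "real \<Rightarrow> 'n::finite field1 \<Rightarrow> (real^'n) set \<Rightarrow> real^'n \<Rightarrow> (real^'n) set" where
  "Lambda \<kappa> F \<Omega> x = {v. \<forall>a\<in>\<Omega>. \<forall>b\<in>\<Omega>. norm (v - v_ab \<kappa> F a b) \<le> r_ab \<kappa> F a b x}"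

definition Psi_plus ::
    "real \<Rightarrow> 'n::finite field1 \<Rightarrow> real^'n \<Rightarrow> real^'n \<Rightarrow> real^'n \<Rightarrow> real" where
  "Psi_plus \<kappa> F x a v =
     val F a + (1/2) * ((der F a + v) \<bullet> (x - a))
     + (\<kappa>/4) * (norm (a - x))\<^sup>2 - (1 / (4*\<kappa>)) * (norm (der F a - v))\<^sup>2"

definition Psi_minus ::
    "real \<Rightarrow> 'n::finite field1 \<Rightarrow> real^'n \<Rightarrow> real^'n \<Rightarrow> real^'n \<Rightarrow> real" where
  "Psi_minus \<kappa> F x a v =
     val F a + (1/2) * ((der F a + v) \<bullet> (x - a))
     - (\<kappa>/4) * (norm (a - x))\<^sup>2 + (1 / (4*\<kappa>)) * (norm (der F a - v))\<^sup>2"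

text \<open>
  The inner infimum and supremum are taken in the extended reals, so that no boundedness in
  \<open>a\<close> is presupposed. The outer operators are genuine maximum and minimum, i.e. the greatest
  and the least element of the set of values. They exist when \<open>\<kappa> > 0\<close>, \<open>\<Omega> \<noteq> {}\<close> and
  \<open>Lambda \<kappa> F \<Omega> x \<noteq> {}\<close>: the latter set is an intersection of closed balls, hence compact,
  and the maximised (minimised) function is upper (lower) semicontinuous in \<open>v\<close>.
\<close>

definition u_plus :: "real \<Rightarrow> 'n::finite field1 \<Rightarrow> (real^'n) set \<Rightarrow> real^'n \<Rightarrow> ereal" where
  "u_plus \<kappa> F \<Omega> x =
     (GREATEST m. m \<in> (\<lambda>v. INF a\<in>\<Omega>. ereal (Psi_plus \<kappa> F x a v)) ` Lambda \<kappa> F \<Omega> x)"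

definition u_minus :: "real \<Rightarrow> 'n::finite field1 \<Rightarrow> (real^'n) set \<Rightarrow> real^'n \<Rightarrow> ereal" where
  "u_minus \<kappa> F \<Omega> x =
     (LEAST m. m \<in> (\<lambda>v. SUP a\<in>\<Omega>. ereal (Psi_minus \<kappa> F x a v)) ` Lambda \<kappa> F \<Omega> x)"

end

theory Submission
  imports Defs
begin

text \<open>
  Let \<open>G\<close> be a minimal extension of \<open>F\<close> and \<open>x\<close> a point. The gradient \<open>v\<close> of \<open>G\<close> at \<open>x\<close> is an
  admissible competitor in both variational problems, and its value there already bounds
  \<open>g(x)\<close>. Since \<open>\<Gamma>\<^sup>1(G) = \<kappa>\<close>, for every \<open>a\<close> the polynomials \<open>G(x)\<close> and \<open>G(a)\<close> differ at a
  point \<open>z\<close> by at most \<open>\<kappa>/2 (\<parallel>x - z\<parallel>\<^sup>2 + \<parallel>a - z\<parallel>\<^sup>2)\<close>. The difference of the two sides is a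
  quadratic polynomial in \<open>z\<close>, and evaluating the inequality at its minimiser gives exactly
  \<open>g(x) \<le> \<Psi>\<^sup>+(F, x, a, v)\<close> for \<open>a \<in> \<Omega>\<close> (lemma \<open>val_le_Psi_plus\<close>). The inequality
  \<open>\<Psi>\<^sup>-(F, x, a, v) \<le> g(x)\<close> is the same statement with \<open>x\<close> and \<open>a\<close> interchanged.

  Consequently \<open>\<Psi>\<^sup>-(F, x, b, v) \<le> \<Psi>\<^sup>+(F, x, a, v)\<close> for all \<open>a, b \<in> \<Omega>\<close>. Completing the square
  in \<open>v\<close> turns this into \<open>\<parallel>v - v\<^sub>a\<^sub>b\<parallel>\<^sup>2 \<le> \<alpha>\<^sub>a\<^sub>b + \<beta>\<^sub>a\<^sub>b(x)\<close>, that is, \<open>v \<in> \<Lambda>\<^sub>x\<close>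
  (lemma \<open>Psi_plus_minus_Psi_minus\<close>).

  There remains the existence of the outer maximum and minimum, without which \<open>u\<^sup>+\<close> and \<open>u\<^sup>-\<close>
  would be arbitrary values. It holds because \<open>\<Lambda>\<^sub>x\<close> is compact and an infimum of continuous
  functions is upper semicontinuous (lemma \<open>INF_attains_max_on_compact\<close>).
\<close>

text \<open>
  A maximising sequence has a convergent subsequence in \<open>K\<close>. At its limit each single \<open>f a\<close>
  is, by continuity, at least the supremum of the values of the infimum, hence so is the
  infimum over \<open>a\<close>. Values in the extended reals allow this infimum to be \<open>-\<infinity>\<close>.
\<close>

lemma INF_attains_max_on_compact:
  fixes f :: "'a \<Rightarrow> 'b::metric_space \<Rightarrow> real"
  assumes "compact K" "K \<noteq> {}" and cont: "\<And>a. a \<in> A \<Longrightarrow> continuous_on K (f a)"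
  shows "\<exists>v\<in>K. \<forall>w\<in>K. (INF a\<in>A. ereal (f a w)) \<le> (INF a\<in>A. ereal (f a v))"
proof -
  define \<phi> where "\<phi> w = (INF a\<in>A. ereal (f a w))" for w
  obtain s :: "nat \<Rightarrow> ereal" where s: "incseq s" "range s \<subseteq> \<phi> ` K" "Sup (\<phi> ` K) = (SUP i. s i)"
    using Sup_countable_SUP[of "\<phi> ` K"] \<open>K \<noteq> {}\<close> by auto
  have "\<forall>i. \<exists>w\<in>K. s i = \<phi> w" using s(2) by blast
  then obtain w where w: "\<And>i. w i \<in> K" "\<And>i. s i = \<phi> (w i)" by metis
  obtain l r where lr: "l \<in> K" "strict_mono r" "(w \<circ> r) \<longlonglongrightarrow> l"
    using \<open>compact K\<close> w(1) unfolding compact_def by metis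
  have "s \<longlonglongrightarrow> Sup (\<phi> ` K)" using LIMSEQ_SUP[OF s(1)] s(3) by simp
  then have lim: "(\<lambda>i. \<phi> (w (r i))) \<longlonglongrightarrow> Sup (\<phi> ` K)"
    using LIMSEQ_subseq_LIMSEQ[OF _ lr(2), of s] by (simp add: o_def flip: w(2))
  have "Sup (\<phi> ` K) \<le> ereal (f a l)" if "a \<in> A" for a
  proof (rule LIMSEQ_le[OF lim])
    have "(\<lambda>i. f a (w (r i))) \<longlonglongrightarrow> f a l"
      using continuous_on_tendsto_compose[OF cont[OF that] lr(3) lr(1)] w(1) by (simp add: o_def)
    then show "(\<lambda>i. ereal (f a (w (r i)))) \<longlonglongrightarrow> ereal (f a l)" by simp
    show "\<exists>N. \<forall>n\<ge>N. \<phi> (w (r n)) \<le> ereal (f a (w (r n)))"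
      unfolding \<phi>_def using that by (blast intro: INF_lower)
  qed
  then have "Sup (\<phi> ` K) \<le> \<phi> l" unfolding \<phi>_def by (rule INF_greatest)
  moreover have "\<phi> w \<le> Sup (\<phi> ` K)" if "w \<in> K" for w using that by (rule SUP_upper)
  ultimately have "\<forall>w\<in>K. \<phi> w \<le> \<phi> l" by (meson order_trans)
  with lr(1) show ?thesis unfolding \<phi>_def by blast
qed

lemma INF_le_Greatest_on_compact:
  fixes f :: "'a \<Rightarrow> 'b::metric_space \<Rightarrow> real"
  assumes "compact K" "\<And>a. a \<in> A \<Longrightarrow> continuous_on K (f a)" "v \<in> K"
  shows "(INF a\<in>A. ereal (f a v)) \<le> (GREATEST m. m \<in> (\<lambda>w. INF a\<in>A. ereal (f a w)) ` K)"
proof -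
  obtain u where u: "u \<in> K" "\<forall>w\<in>K. (INF a\<in>A. ereal (f a w)) \<le> (INF a\<in>A. ereal (f a u))"
    using INF_attains_max_on_compact[of K A f] assms by (metis empty_iff)
  then have "(GREATEST m. m \<in> (\<lambda>w. INF a\<in>A. ereal (f a w)) ` K) = (INF a\<in>A. ereal (f a u))"
    by (intro Greatest_equality) auto
  with u assms(3) show ?thesis by simp
qed

lemma Least_le_SUP_on_compact:
  fixes f :: "'a \<Rightarrow> 'b::metric_space \<Rightarrow> real"
  assumes "compact K" and cont: "\<And>a. a \<in> A \<Longrightarrow> continuous_on K (f a)" and "v \<in> K"
  shows "(LEAST m. m \<in> (\<lambda>w. SUP a\<in>A. ereal (f a w)) ` K) \<le> (SUP a\<in>A. ereal (f a v))"
proof -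
  have neg: "(INF a\<in>A. ereal (- f a w)) = - (SUP a\<in>A. ereal (f a w))" for w
    using ereal_INF_uminus_eq[of "\<lambda>a. ereal (f a w)" A] by simp
  have "continuous_on K (\<lambda>v. - f a v)" if "a \<in> A" for a
    using cont[OF that] by (rule continuous_on_minus)
  then obtain u where u: "u \<in> K"
      "\<forall>w\<in>K. (INF a\<in>A. ereal (- f a w)) \<le> (INF a\<in>A. ereal (- f a u))"
    using INF_attains_max_on_compact[of K A "\<lambda>a v. - f a v"] assms(1,3) by (metis empty_iff)
  then have min: "\<forall>w\<in>K. (SUP a\<in>A. ereal (f a u)) \<le> (SUP a\<in>A. ereal (f a w))"
    by (simp add: neg)
  with u(1) have "(LEAST m. m \<in> (\<lambda>w. SUP a\<in>A. ereal (f a w)) ` K) = (SUP a\<in>A. ereal (f a u))"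
    by (intro Least_equality) auto
  with min assms(3) show ?thesis by simp
qed

lemma compact_Lambda:
  assumes "\<Omega> \<noteq> {}"
  shows "compact (Lambda \<kappa> F \<Omega> x)"
proof -
  have "Lambda \<kappa> F \<Omega> x = (\<Inter>(a, b)\<in>\<Omega> \<times> \<Omega>. cball (v_ab \<kappa> F a b) (r_ab \<kappa> F a b x))"
    by (auto simp: Lambda_def dist_norm norm_minus_commute)
  moreover have "compact \<dots>"
    using assms by (intro compact_Inter) auto
  ultimately show ?thesis by simp
qed

lemma poly1_diff_le_of_Gamma1:
  assumes "Gamma1 G \<Omega> \<le> ennreal \<kappa>" "\<kappa> \<ge> 0" "x \<in> \<Omega>" "y \<in> \<Omega>"
  shows "poly1 G x z - poly1 G y z \<le> \<kappa>/2 * ((norm (x - z))\<^sup>2 + (norm (y - z))\<^sup>2)"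
proof (cases "x = y")
  case True
  then show ?thesis using assms(2) by simp
next
  case False
  define N where "N = (norm (x - z))\<^sup>2 + (norm (y - z))\<^sup>2"
  define q where "q = \<bar>poly1 G x z - poly1 G y z\<bar> / N"
  have "N > 0"
    using False unfolding N_def by (cases "x = z") (auto intro: add_pos_nonneg)
  have "ennreal (2 * q) = 2 * ennreal q"
    by (simp only: ennreal_mult' zero_le_numeral ennreal_numeral)
  also have "\<dots> \<le> Gamma1_pt G x y"
    unfolding Gamma1_pt_def q_def N_def by (intro mult_left_mono SUP_upper) auto
  also have "\<dots> \<le> Gamma1 G \<Omega>"
    unfolding Gamma1_def using False assms(3,4) by (auto intro: SUP_upper2[of "(x, y)"])
  finally have "2 * q \<le> \<kappa>"
    using assms(1,2) by (meson ennreal_le_iff order_trans)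
  then have "\<bar>poly1 G x z - poly1 G y z\<bar> \<le> \<kappa>/2 * N"
    using \<open>N > 0\<close> by (simp add: q_def field_simps)
  then show ?thesis unfolding N_def by linarith
qed

text \<open>
  The quantity \<open>\<Psi>\<^sup>+(G, x, y, D\<^sub>xg) - g(x)\<close> is the minimum over \<open>z\<close> of the slack in the
  hypothesis, by the parallelogram identity centred at the midpoint of \<open>x\<close> and \<open>y\<close>.
\<close>

lemma val_le_Psi_plus:
  fixes G :: "'n::finite field1"
  assumes "\<kappa> > 0"
    and bound: "\<And>z. poly1 G x z - poly1 G y z \<le> \<kappa>/2 * ((norm (x - z))\<^sup>2 + (norm (y - z))\<^sup>2)"
  shows "val G x \<le> Psi_plus \<kappa> G x y (der G x)"
proof -
  \<comment> \<open>The minimiser of the slack is the midpoint shifted by \<open>w\<close>.\<close>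
  define w where "w = (1/(2*\<kappa>)) *\<^sub>R (der G x - der G y)"
  define z where "z = (1/2) *\<^sub>R (x + y) + w"
  have zx: "z - x = w - (1/2) *\<^sub>R (x - y)" and zy: "z - y = w + (1/2) *\<^sub>R (x - y)"
    by (simp_all add: z_def vec_eq_iff field_simps)
  have sum: "(norm (x - z))\<^sup>2 + (norm (y - z))\<^sup>2 = 2 * (norm w)\<^sup>2 + (1/2) * (norm (x - y))\<^sup>2"
  proof -
    have "(norm (w - h))\<^sup>2 + (norm (w + h))\<^sup>2 = 2 * (norm w)\<^sup>2 + 2 * (norm h)\<^sup>2" for h
      by (simp add: power2_norm_eq_inner inner_diff_left inner_diff_right inner_add_left
          inner_add_right)
    from this[of "(1/2) *\<^sub>R (x - y)"] show ?thesis
      unfolding norm_minus_commute[of _ z] zx zy by (simp add: power_mult_distrib power2_eq_square)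
  qed
  have dif: "poly1 G x z - poly1 G y z =
      val G x - val G y - (1/2) * ((der G x + der G y) \<bullet> (x - y)) + (der G x - der G y) \<bullet> w"
    unfolding poly1_def zx zy
    by (simp add: inner_diff_left inner_diff_right inner_add_left inner_add_right field_simps)
  have lin: "(der G x - der G y) \<bullet> w = (1/(2*\<kappa>)) * (norm (der G x - der G y))\<^sup>2"
    by (simp add: w_def power2_norm_eq_inner)
  have quad: "\<kappa> * (norm w)\<^sup>2 = (1/(4*\<kappa>)) * (norm (der G x - der G y))\<^sup>2"
    using \<open>\<kappa> > 0\<close> by (simp add: w_def power_mult_distrib power2_eq_square)
  have two: "(1/(2*\<kappa>)) * D = 2 * ((1/(4*\<kappa>)) * D)" for D :: real by simp
  have "\<kappa>/2 * (2 * (norm w)\<^sup>2 + (1/2) * (norm (x - y))\<^sup>2)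
      = \<kappa> * (norm w)\<^sup>2 + (\<kappa>/4) * (norm (x - y))\<^sup>2"
    by (simp add: algebra_simps)
  then show ?thesis
    using bound[of z] lin unfolding sum dif quad two Psi_plus_def
    by (simp add: norm_minus_commute add.commute)
qed

lemma Psi_minus_le_val:
  assumes "val G y \<le> Psi_plus \<kappa> G y x (der G y)"
  shows "Psi_minus \<kappa> G x y (der G x) \<le> val G x"
proof -
  have "(der G x + der G y) \<bullet> (y - x) = - ((der G y + der G x) \<bullet> (x - y))"
    by (simp add: algebra_simps inner_diff_right)
  with assms show ?thesis
    by (simp add: Psi_plus_def Psi_minus_def norm_minus_commute)
qed

text \<open>
  The core of the identity \<open>Psi_plus_minus_Psi_minus\<close> below, with \<open>p = D\<^sub>af\<close>, \<open>q = D\<^sub>bf\<close>,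
  \<open>s = \<kappa>(x - a)\<close> and \<open>t = \<kappa>(x - b)\<close>; this scaling removes \<open>\<kappa>\<close> from the computation.
\<close>

lemma complete_square_in_gradient:
  fixes p q s t v :: "'a::real_inner"
  shows "(p + v) \<bullet> s - (q + v) \<bullet> t + (1/2) * ((norm s)\<^sup>2 + (norm t)\<^sup>2)
      - ((norm (p - v))\<^sup>2/2 + (norm (q - v))\<^sup>2/2)
    = (p + q) \<bullet> (s - t) - (1/2) * (norm (p - q))\<^sup>2 + (1/2) * (norm (s - t))\<^sup>2
      + (norm ((1/2) *\<^sub>R (p - q) + (1/2) *\<^sub>R (s + t)))\<^sup>2
      - (norm (v - ((1/2) *\<^sub>R (p + q) + (1/2) *\<^sub>R (s - t))))\<^sup>2"
  unfolding power2_norm_eq_inner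
  by (simp add: inner_diff_left inner_diff_right inner_add_left inner_add_right
      inner_commute field_simps)

text \<open>
  Completing the square in \<open>v\<close>: this identity is where \<open>v\<^sub>a\<^sub>b\<close>, \<open>\<alpha>\<^sub>a\<^sub>b\<close> and \<open>\<beta>\<^sub>a\<^sub>b\<close> come from. It
  shows that \<open>\<Lambda>\<^sub>x\<close> consists of those \<open>v\<close> for which all lower bounds \<open>\<Psi>\<^sup>-\<close> lie below all upper
  bounds \<open>\<Psi>\<^sup>+\<close>.
\<close>

lemma Psi_plus_minus_Psi_minus:
  fixes F :: "'n::finite field1"
  assumes "\<kappa> > 0"
  shows "2 * \<kappa> * (Psi_plus \<kappa> F x a v - Psi_minus \<kappa> F x b v) =
    alpha_ab \<kappa> F a b + beta_ab \<kappa> F a b x - (norm (v - v_ab \<kappa> F a b))\<^sup>2"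
proof -
  have quarter: "2 * \<kappa> * ((1/(4*\<kappa>)) * D) = D/2" for D :: real
    using assms by simp
  have "2 * \<kappa> * (Psi_plus \<kappa> F x a v - Psi_minus \<kappa> F x b v) =
      2 * \<kappa> * (val F a - val F b) + \<kappa> * ((der F a + v) \<bullet> (x - a)) - \<kappa> * ((der F b + v) \<bullet> (x - b))
      + \<kappa>\<^sup>2/2 * ((norm (a - x))\<^sup>2 + (norm (b - x))\<^sup>2)
      - (2 * \<kappa> * ((1/(4*\<kappa>)) * (norm (der F a - v))\<^sup>2) + 2 * \<kappa> * ((1/(4*\<kappa>)) * (norm (der F b - v))\<^sup>2))"
    unfolding Psi_plus_def Psi_minus_def by (simp add: algebra_simps power2_eq_square)
  also have "\<dots> = alpha_ab \<kappa> F a b + beta_ab \<kappa> F a b x - (norm (v - v_ab \<kappa> F a b))\<^sup>2"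
  proof -
    have vecs: "\<kappa> *\<^sub>R (x - a) - \<kappa> *\<^sub>R (x - b) = \<kappa> *\<^sub>R (b - a)"
      "(1/2) *\<^sub>R (\<kappa> *\<^sub>R (x - a) + \<kappa> *\<^sub>R (x - b)) = (\<kappa>/2) *\<^sub>R (2 *\<^sub>R x - a - b)"
      "(1/2) *\<^sub>R \<kappa> *\<^sub>R (b - a) = (\<kappa>/2) *\<^sub>R (b - a)"
      by (simp_all add: vec_eq_iff algebra_simps)
    have norms: "(norm (\<kappa> *\<^sub>R u))\<^sup>2 = \<kappa>\<^sup>2 * (norm u)\<^sup>2" for u :: "real^'n"
      by (simp add: power_mult_distrib)
    show ?thesis
      using complete_square_in_gradient[where p = "der F a" and q = "der F b" and v = v
          and s = "\<kappa> *\<^sub>R (x - a)" and t = "\<kappa> *\<^sub>R (x - b)"]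
      unfolding quarter alpha_ab_def beta_ab_def v_ab_def vecs norms inner_scaleR_right
        norm_minus_commute[of x] norm_minus_commute[of b a]
      by (simp only: ring_distribs)
  qed
  finally show ?thesis .
qed

lemma mem_Lambda:
  assumes "\<kappa> > 0" and "\<And>a b. a \<in> \<Omega> \<Longrightarrow> b \<in> \<Omega> \<Longrightarrow> Psi_minus \<kappa> F x b v \<le> Psi_plus \<kappa> F x a v"
  shows "v \<in> Lambda \<kappa> F \<Omega> x"
  unfolding Lambda_def r_ab_def
proof (intro CollectI ballI real_le_rsqrt)
  fix a b assume "a \<in> \<Omega>" "b \<in> \<Omega>"
  then have "0 \<le> 2 * \<kappa> * (Psi_plus \<kappa> F x a v - Psi_minus \<kappa> F x b v)"
    using assms by simp
  then show "(norm (v - v_ab \<kappa> F a b))\<^sup>2 \<le> alpha_ab \<kappa> F a b + beta_ab \<kappa> F a b x"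
    unfolding Psi_plus_minus_Psi_minus[OF assms(1)] by simp
qed

theorem corollary25:
  fixes F :: "'n::finite field1" and \<Omega> :: "(real^'n) set" and \<kappa> :: real
  assumes "\<Omega> \<noteq> {}"
    and "F \<in> F1 \<Omega>"
    and "\<kappa> = enn2real (Gamma1 F \<Omega>)"
    and "\<kappa> > 0"
  shows "\<forall>G. minimal_extension F \<Omega> G \<longrightarrow>
           (\<forall>x. u_minus \<kappa> F \<Omega> x \<le> ereal (val G x) \<and> ereal (val G x) \<le> u_plus \<kappa> F \<Omega> x)"
proof (intro allI impI)
  fix G x assume G: "minimal_extension F \<Omega> G"
  define v where "v = der G x"
  have "Gamma1 G UNIV = ennreal \<kappa>"
    using G assms(2,3) by (simp add: minimal_extension_def F1_def)
  then have G_le: "val G y \<le> Psi_plus \<kappa> G y z (der G y)" for y z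
    using assms(4) by (intro val_le_Psi_plus poly1_diff_le_of_Gamma1[where \<Omega> = UNIV]) auto
  have eq: "val F a = val G a" "der F a = der G a" if "a \<in> \<Omega>" for a
    using G that by (simp_all add: minimal_extension_def val_def der_def)
  have upper: "val G x \<le> Psi_plus \<kappa> F x a v" if "a \<in> \<Omega>" for a
    using G_le[of x a] eq[OF that] by (simp add: Psi_plus_def v_def)
  have lower: "Psi_minus \<kappa> F x a v \<le> val G x" if "a \<in> \<Omega>" for a
    using Psi_minus_le_val[OF G_le[of a x]] eq[OF that] by (simp add: Psi_minus_def v_def)
  have v: "v \<in> Lambda \<kappa> F \<Omega> x"
    using upper lower by (intro mem_Lambda assms(4)) (meson order_trans)
  note comp = compact_Lambda[OF assms(1)]
  have "u_minus \<kappa> F \<Omega> x \<le> (SUP a\<in>\<Omega>. ereal (Psi_minus \<kappa> F x a v))"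
    unfolding u_minus_def
    by (rule Least_le_SUP_on_compact[OF comp _ v])
      (use assms(4) in \<open>auto simp: Psi_minus_def intro!: continuous_intros\<close>)
  also have "\<dots> \<le> ereal (val G x)"
    using lower by (intro SUP_least) simp
  finally have "u_minus \<kappa> F \<Omega> x \<le> ereal (val G x)" .
  moreover have "ereal (val G x) \<le> (INF a\<in>\<Omega>. ereal (Psi_plus \<kappa> F x a v))"
    using upper by (intro INF_greatest) simp
  moreover have "(INF a\<in>\<Omega>. ereal (Psi_plus \<kappa> F x a v)) \<le> u_plus \<kappa> F \<Omega> x"
    unfolding u_plus_def
    by (rule INF_le_Greatest_on_compact[OF comp _ v])
      (use assms(4) in \<open>auto simp: Psi_plus_def intro!: continuous_intros\<close>)
  ultimately show "u_minus \<kappa> F \<Omega> x \<le> ereal (val G x) \<and> ereal (val G x) \<le> u_plus \<kappa> F \<Omega> x"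
    by (meson order_trans)
qed

end
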